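(* Consider the descriptor system $E\dot x(t)=Ax(t)+B_Ku_K(t)$, $y(t)=Cx(t)+D_Ku_K(t)$ with attack set $K\subseteq\{1,\dots,n+p\}$, where $(E,A)$ is regular, the initial condition $x(0)$ is consistent, and the input is smooth. Assume that the attack set $K$ is detectable and that the initial state $x(0)$ is known. Consider the centralized attack detection filter $$E\dot w(t)=(A+GC)w(t)-Gy(t),\qquad r(t)=Cw(t)-y(t),$$ where $w(0)=x(0)$ and the output injection $G\in\mathbb R^{n\times p}$ is such that the pair $(E,A+GC)$ is regular and Hurwitz. Then $r(t)=0$ at all times $t\in\mathbb R_{\ge 0}$ if and only if $u_K(t)=0$ at all times $t\in\mathbb R_{\ge 0}$. Moreover, in the absence of attacks, the filter error $w(t)-x(t)$ is exponentially stable.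
   Context: Setting: the descriptor system is $E\dot x(t)=Ax(t)+Bu(t)$, $y(t)=Cx(t)+Du(t)$, with $x(t)\in\mathbb R^n$, $y(t)\in\mathbb R^p$, $E,A\in\mathbb R^{n\times n}$ ($E$ possibly singular), $C\in\mathbb R^{p\times n}$, $B=[I_n\;\,0]\in\mathbb R^{n\times(n+p)}$, $D=[0\;\,I_p]\in\mathbb R^{p\times(n+p)}$, and unknown input $u(t)\in\mathbb R^{n+p}$. For an attack set $K\subseteq\{1,\dots,n+p\}$, $B_K,D_K$ are the submatrices of $B,D$ with columns in $K$, and $u_K(t)\in\mathbb R^{|K|}$ (the attack mode) is the subvector of $u(t)$ indexed by $K$. In the presence of attackers indexed by $K$, exactly the entries of $u$ indexed by $K$ are nonzero over time (each is not identically zero, the others vanish identically), so $Bu=B_Ku_K$, $Du=D_Ku_K$. Absence of attacks means $u\equiv 0$. Standing assumptions: $(E,A)$ is regular, i.e. $\det(sE-A)$ does not vanish identically; $x(0)$ is consistent, i.e. $Ax(0)+Bu(0)$ is orthogonal to $\mathrm{Ker}(E^{\mathsf T})$; $u$ is smooth. $y(x_0,u,t)$ denotes the output generated from initial state $x_0$ under the attack signal $u$. The attack set $K$ is undetectable if there exist initial conditions $x_1,x_2\in\mathbb R^n$ and an attack mode $u_K$ such that $y(x_1,u_K,t)=y(x_2,0,t)$ for all $t\ge 0$; otherwise $K$ is detectable. A regular pair $(E,M)$ is Hurwitz if all its finite generalized eigenvalues (roots of $\det(sE-M)$) have negative real part. *)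

theory Defs
  imports "HOL-Analysis.Analysis"
begin

text \<open>
  Input channels are indexed by the sum type \<open>'n + 'p\<close>: \<open>Inl i\<close> is the \<open>i\<close>-th state attack,
  \<open>Inr j\<close> the \<open>j\<close>-th output attack. Signals are functions on the reals of which only the values
  on \<open>{0..}\<close> matter; all derivatives are taken within \<open>{0..}\<close> (one-sided at 0).
\<close>

definition B_mat :: "real^('n::finite + 'p::finite)^'n" where
  "B_mat = (\<chi> i k. case k of Inl j \<Rightarrow> (if i = j then 1 else 0) | Inr _ \<Rightarrow> 0)"

definition D_mat :: "real^('n::finite + 'p::finite)^'p" where
  "D_mat = (\<chi> i k. case k of Inl _ \<Rightarrow> 0 | Inr j \<Rightarrow> (if i = j then 1 else 0))"

text \<open>The product \<open>M\<^sub>K v\<^sub>K\<close> of the submatrix of columns in \<open>K\<close> with the subvector indexed by \<open>K\<close>.\<close>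

definition cols_mult :: "real^'k^'m \<Rightarrow> 'k::finite set \<Rightarrow> real^'k \<Rightarrow> real^'m" where
  "cols_mult M K v = (\<Sum>k\<in>K. (v $ k) *\<^sub>R column k M)"

definition pencil :: "real^'n^'n \<Rightarrow> real^'n^'n \<Rightarrow> complex \<Rightarrow> complex^'n^'n" where
  "pencil E M s = (\<chi> i j. s * complex_of_real (E $ i $ j) - complex_of_real (M $ i $ j))"

definition regular_pair :: "real^'n^'n \<Rightarrow> real^'n^'n \<Rightarrow> bool" where
  "regular_pair E M \<longleftrightarrow> (\<exists>s. det (pencil E M s) \<noteq> 0)"

definition hurwitz_pair :: "real^'n^'n \<Rightarrow> real^'n^'n \<Rightarrow> bool" where
  "hurwitz_pair E M \<longleftrightarrow> (\<forall>s. det (pencil E M s) = 0 \<longrightarrow> Re s < 0)"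

definition smooth_signal :: "(real \<Rightarrow> 'a::real_normed_vector) \<Rightarrow> bool" where
  "smooth_signal u \<longleftrightarrow>
     (\<exists>d :: nat \<Rightarrow> real \<Rightarrow> 'a.
        (\<forall>t\<ge>0. d 0 t = u t) \<and>
        (\<forall>m. \<forall>t\<ge>0. (d m has_vector_derivative d (Suc m) t) (at t within {0..})))"

text \<open>\<open>x\<close> is a (classical) solution of \<open>E x' = M x + f\<close> on \<open>t \<ge> 0\<close>.\<close>

definition descriptor_solution ::
  "real^'n^'n \<Rightarrow> real^'n^'n \<Rightarrow> (real \<Rightarrow> real^'n) \<Rightarrow> (real \<Rightarrow> real^'n) \<Rightarrow> bool" where
  "descriptor_solution E M f x \<longleftrightarrow>
     (\<forall>t\<ge>0. \<exists>x'. (x has_vector_derivative x') (at t within {0..}) \<and> E *v x' = M *v x t + f t)"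

definition consistent :: "real^'n^'n \<Rightarrow> real^'n^'n \<Rightarrow> real^'n \<Rightarrow> real^'n \<Rightarrow> bool" where
  "consistent E A x0 f0 \<longleftrightarrow> (\<forall>v. transpose E *v v = 0 \<longrightarrow> orthogonal (A *v x0 + f0) v)"

text \<open>The attacked system, with state \<open>x\<close> and output \<open>y\<close>.\<close>

definition plant ::
  "real^'n^'n \<Rightarrow> real^'n^'n \<Rightarrow> real^'n^'p \<Rightarrow> ('n::finite + 'p::finite) set \<Rightarrow>
   (real \<Rightarrow> real^('n + 'p)) \<Rightarrow> (real \<Rightarrow> real^'n) \<Rightarrow> (real \<Rightarrow> real^'p) \<Rightarrow> bool" where
  "plant E A C K u x y \<longleftrightarrow>
     consistent E A (x 0) (cols_mult B_mat K (u 0)) \<and>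
     descriptor_solution E A (\<lambda>t. cols_mult B_mat K (u t)) x \<and>
     (\<forall>t\<ge>0. y t = C *v x t + cols_mult D_mat K (u t))"

definition no_attack :: "(real \<Rightarrow> real^'k) \<Rightarrow> bool" where
  "no_attack u \<longleftrightarrow> (\<forall>t\<ge>0. u t = 0)"

text \<open>
  Exactly the entries indexed by \<open>K\<close> are nonzero over time. The mode is kept as a full input
  vector, so that \<open>u\<^sub>K\<close> is its restriction to \<open>K\<close>.
\<close>

definition attack_mode :: "'k::finite set \<Rightarrow> (real \<Rightarrow> real^'k) \<Rightarrow> bool" where
  "attack_mode K u \<longleftrightarrow>
     smooth_signal u \<and>
     (\<forall>k\<in>K. \<exists>t\<ge>0. u t $ k \<noteq> 0) \<and>
     (\<forall>k. k \<notin> K \<longrightarrow> (\<forall>t\<ge>0. u t $ k = 0))"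

text \<open>
  The relation \<open>y = y(x\<^sub>0, u, \<cdot>)\<close>. It is a relation rather than a function because the consistency
  condition does not guarantee a solution for every initial state; for a regular
  pair \<open>y\<close> is unique on \<open>t \<ge> 0\<close> if it exists.
\<close>

definition generates_output ::
  "real^'n^'n \<Rightarrow> real^'n^'n \<Rightarrow> real^'n^'p \<Rightarrow> ('n::finite + 'p::finite) set \<Rightarrow>
   real^'n \<Rightarrow> (real \<Rightarrow> real^('n + 'p)) \<Rightarrow> (real \<Rightarrow> real^'p) \<Rightarrow> bool" where
  "generates_output E A C K x0 u y \<longleftrightarrow> (\<exists>x. x 0 = x0 \<and> plant E A C K u x y)"

definition undetectable ::
  "real^'n^'n \<Rightarrow> real^'n^'n \<Rightarrow> real^'n^'p \<Rightarrow> ('n::finite + 'p::finite) set \<Rightarrow> bool" where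
  "undetectable E A C K \<longleftrightarrow>
     (\<exists>x1 x2 u y1 y2. attack_mode K u \<and>
        generates_output E A C K x1 u y1 \<and>
        generates_output E A C K x2 (\<lambda>_. 0) y2 \<and>
        (\<forall>t\<ge>0. y1 t = y2 t))"

definition detectable ::
  "real^'n^'n \<Rightarrow> real^'n^'n \<Rightarrow> real^'n^'p \<Rightarrow> ('n::finite + 'p::finite) set \<Rightarrow> bool" where
  "detectable E A C K \<longleftrightarrow> \<not> undetectable E A C K"

definition detection_filter ::
  "real^'n^'n \<Rightarrow> real^'n^'n \<Rightarrow> real^'n^'p \<Rightarrow> real^'p^'n \<Rightarrow>
   (real \<Rightarrow> real^'p) \<Rightarrow> (real \<Rightarrow> real^'n) \<Rightarrow> (real \<Rightarrow> real^'p) \<Rightarrow> bool" where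
  "detection_filter E A C G y w r \<longleftrightarrow>
     descriptor_solution E (A + G ** C) (\<lambda>t. - (G *v y t)) w \<and>
     (\<forall>t\<ge>0. r t = C *v w t - y t)"

text \<open>
  Exponential stability of the origin for a family of trajectories: the constants are uniform
  over all members of the family.
\<close>

definition exponentially_stable :: "(real \<Rightarrow> 'a::real_normed_vector) set \<Rightarrow> bool" where
  "exponentially_stable S \<longleftrightarrow>
     (\<exists>c>0. \<exists>a>0. \<forall>e\<in>S. \<forall>t\<ge>0. norm (e t) \<le> c * exp (- a * t) * norm (e 0))"

text \<open>
  The filter errors \<open>w - x\<close> without attacks. The filter may start at any \<open>w 0\<close>: with
  \<open>w 0 = x 0\<close> the error would vanish identically and stability would be void.
\<close>

definition attack_free_errors ::
  "real^'n^'n \<Rightarrow> real^'n^'n \<Rightarrow> real^'n^'p \<Rightarrow> real^'p^'n \<Rightarrow> ('n::finite + 'p::finite) set \<Rightarrow>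
   (real \<Rightarrow> real^'n) set" where
  "attack_free_errors E A C G K =
     {e. \<exists>u x y w r. no_attack u \<and> plant E A C K u x y \<and> detection_filter E A C G y w r \<and>
           e = (\<lambda>t. w t - x t)}"

end

theory Submission
  imports Defs "HOL-Computational_Algebra.Fundamental_Theorem_Algebra"
begin

text \<open>
  Detectability does one half of the equivalence and stability the other. If the residual \<open>r\<close>
  vanishes, then the injection term of the filter cancels, because \<open>G C w = G y\<close>. So \<open>w\<close> is a
  state trajectory of the unattacked system whose output is \<open>y\<close>, and a nonzero attack producing
  the same \<open>y\<close> would be undetectable (\<open>undetected_filter_generates_output\<close>). If the attack
  vanishes, then the filter error \<open>e = w - x\<close> solves the homogeneous equation \<open>E e' = M e\<close> with
  \<open>M = A + G C\<close> (\<open>attack_free_error_solution\<close>). A uniform bound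
  \<open>\<bar>e(t)\<bar> \<le> c exp(-a t) \<bar>e(0)\<bar>\<close> for the solutions of this equation is the stability claim, and
  it also gives the missing half of the equivalence: \<open>e(0) = 0\<close> forces \<open>e = 0\<close>, whence
  \<open>r = C e = 0\<close>.

  The analytic core is thus the decay estimate \<open>hurwitz_pair_stable\<close>. It is obtained without
  the Weierstrass form of the pencil. Since \<open>0\<close> is not a generalized eigenvalue of a Hurwitz pair,
  \<open>M\<close> is invertible and the equation reads \<open>e = N e'\<close> with \<open>N = M\<^sup>-\<^sup>1 E\<close>, a matrix that is
  singular if \<open>E\<close> is, and whose nonzero eigenvalues are the reciprocals of the generalized
  eigenvalues. Choose a nonzero complex polynomial \<open>p\<close> with \<open>p(N) = 0\<close>. By induction on the linear
  factors of \<open>p\<close>, the solutions annihilated by \<open>p(N)\<close> decay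
  (\<open>annihilated_implicit_solutions_stable\<close>). When a factor \<open>z - N\<close> is split off, the transformed
  solution \<open>f = z e - N e\<close> is annihilated by the remaining product \<open>q(N)\<close>, and there are three
  cases:

  \<^item> \<open>z = 0\<close>: differentiating \<open>q(N) N e = 0\<close> gives \<open>q(N) N e' = q(N) e = 0\<close>, so the factor \<open>N\<close>
    can be dropped. This disposes of the algebraic part of the descriptor system.
  \<^item> \<open>z\<close> is not an eigenvalue of \<open>N\<close>: then \<open>z - N\<close> is bounded below, and \<open>e\<close> inherits the decay
    of \<open>f\<close>.
  \<^item> \<open>z\<close> is a nonzero eigenvalue: with \<open>s = 1/z\<close>, the combination \<open>g = e - s f\<close> equals
    \<open>s N e\<close> and solves the explicit equation \<open>g' = s g + s\<^sup>2 f\<close>, where \<open>Re s < 0\<close> and the forcing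
    term decays.
\<close>

section \<open>Polynomials in a complex matrix\<close>

text \<open>The vector \<open>p(A) v\<close>, by Horner's scheme, which makes induction over \<open>pCons\<close> immediate.\<close>
definition mat_poly :: "complex^'n^'n \<Rightarrow> complex poly \<Rightarrow> complex^'n \<Rightarrow> complex^'n" where
  "mat_poly A p = fold_coeffs (\<lambda>a f v. a *s v + A *v f v) p (\<lambda>_. 0)"

lemma mat_poly_0 [simp]: "mat_poly A 0 v = 0"
  by (simp add: mat_poly_def)

lemma mat_poly_pCons [simp]: "mat_poly A (pCons a p) v = a *s v + A *v mat_poly A p v"
proof (cases "p = 0 \<and> a = 0")
  case False
  then have "mat_poly A (pCons a p) = (\<lambda>v. a *s v + A *v mat_poly A p v)"
    by (auto simp: mat_poly_def)
  then show ?thesis by simp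
qed simp

lemma mat_poly_add: "mat_poly A (p + q) v = mat_poly A p v + mat_poly A q v"
  by (induction p q rule: poly_induct2) (auto simp: vec.add matrix_vector_right_distrib vector_sadd_rdistrib)

lemma mat_poly_sum: "mat_poly A (\<Sum>i\<in>I. p i) v = (\<Sum>i\<in>I. mat_poly A (p i) v)"
  by (induction I rule: infinite_finite_induct) (auto simp: mat_poly_add)

lemma mat_poly_smult: "mat_poly A (smult c p) v = c *s mat_poly A p v"
  by (induction p) (auto simp: vector_add_ldistrib vector_smult_assoc vec.scale)

lemma mat_poly_monom: "mat_poly A (monom c i) v = c *s (((*v) A) ^^ i) v"
  by (induction i) (auto simp: monom_0 monom_Suc vec.scale)

lemma linear_mat_poly: "Vector_Spaces.linear (*s) (*s) (mat_poly A p)"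
proof -
  have "mat_poly A p (v + w) = mat_poly A p v + mat_poly A p w"
       "mat_poly A p (c *s v) = c *s mat_poly A p v" for v w c
    by (induction p) (auto simp: vector_add_ldistrib vector_smult_assoc vec.add vec.scale mult.commute)
  then show ?thesis
    by unfold_locales 
qed

lemma mat_poly_commute: "mat_poly A p (A *v v) = A *v mat_poly A p v"
  by (induction p) (auto simp: vec.add vec.scale)

lemma mat_poly_linear_factor:
  "mat_poly A ([:a, -1:] * p) v = mat_poly A p (a *s v - A *v v)"
proof -
  have "[:a, -1:] * p = smult a p + pCons 0 (smult (-1) p)" by simp
  then show ?thesis
    by (simp only: mat_poly_add mat_poly_smult mat_poly_pCons)
       (simp add: vec.diff vec.scale mat_poly_commute vec.linear_diff[OF linear_mat_poly] 
          vec.linear_scale[OF linear_mat_poly] vec.neg)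
qed

lemma bounded_linear_complex_linear:
  fixes f :: "complex^'n \<Rightarrow> complex^'m"
  assumes "Vector_Spaces.linear (*s) (*s) f"
  shows "bounded_linear f"
proof -
  have "f = (\<lambda>v. matrix f *v v)"
    using matrix_works[OF assms] by (simp add: fun_eq_iff)
  then show ?thesis
    by (metis matrix_vector_mul_bounded_linear)
qed

lemma linear_scalar_minus_matrix:
  "Vector_Spaces.linear (*s) (*s) (\<lambda>v. z *s v - N *v (v :: complex^'n))"
  by unfold_locales (auto simp: algebra_simps vector_add_ldistrib vector_smult_assoc
      vec.add vec.scale)

text \<open>A family and not a set: the powers of a matrix may repeat, and a repetition is also a
  nontrivial relation.\<close>
lemma finite_family_dependent:
  fixes P :: "nat \<Rightarrow> 'a::euclidean_space"
  obtains c :: "nat \<Rightarrow> real" where "\<exists>i\<le>DIM('a). c i \<noteq> 0" "(\<Sum>i\<le>DIM('a). c i *\<^sub>R P i) = 0"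
proof (cases "inj_on P {..DIM('a)}")
  case True
  then have "card (P ` {..DIM('a)}) > DIM('a)"
    by (simp add: card_image)
  then have "dependent (P ` {..DIM('a)})"
    by (intro dependent_biggerset)
  then obtain u where u: "\<exists>v\<in>P ` {..DIM('a)}. u v \<noteq> 0" "(\<Sum>v\<in>P ` {..DIM('a)}. u v *\<^sub>R v) = 0"
    by (auto simp: dependent_finite)
  show ?thesis
    by (rule that[of "u \<circ> P"]) (use u True in \<open>auto simp: sum.reindex\<close>)
next
  case False
  then obtain i j where ij: "i \<le> DIM('a)" "j \<le> DIM('a)" "i \<noteq> j" "P i = P j"
    by (auto simp: inj_on_def)
  let ?c = "\<lambda>k. if k = i then 1 else if k = j then - 1 else (0::real)"
  have "(\<Sum>k\<le>DIM('a). ?c k *\<^sub>R P k) = (\<Sum>k\<in>{i, j}. ?c k *\<^sub>R P k)"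
    using ij by (intro sum.mono_neutral_right) auto
  also have "\<dots> = 0"
    using ij by simp
  finally show ?thesis
    using ij by (intro that[of ?c]) auto
qed

text \<open>The powers of \<open>A\<close> live in a finite-dimensional real space, so a nontrivial real combination
  of finitely many of them vanishes; its coefficients are those of \<open>p\<close>.\<close>
lemma annihilating_polynomial:
  fixes A :: "complex^'n^'n"
  obtains p where "p \<noteq> 0" "\<And>v. mat_poly A p v = 0"
proof -
  define P where "P i = ((**) A ^^ i) (mat 1)" for i
  have P: "P i *v v = (((*v) A) ^^ i) v" for i v
    by (induction i) (auto simp: P_def matrix_vector_mul_assoc [symmetric])
  define d where "d = DIM(complex^'n^'n)"
  obtain c :: "nat \<Rightarrow> real" where c: "\<exists>i\<le>d. c i \<noteq> 0" "(\<Sum>i\<le>d. c i *\<^sub>R P i) = 0"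
    unfolding d_def using finite_family_dependent[of P] by metis
  define p where "p = (\<Sum>i\<le>d. monom (complex_of_real (c i)) i)"
  have coeff: "coeff p i = c i" if "i \<le> d" for i
    using that by (simp add: p_def coeff_sum)
  have "p \<noteq> 0"
    using c(1) coeff by force
  moreover have "mat_poly A p v = 0" for v
  proof -
    have scale: "complex_of_real r *s w = r *\<^sub>R w" for r and w :: "complex^'n"
      by (simp add: vec_eq_iff scaleR_conv_of_real[where 'a = complex])
    have "mat_poly A p v = (\<Sum>i\<le>d. c i *\<^sub>R (P i *v v))"
      by (simp add: p_def mat_poly_sum mat_poly_monom scale P)
    also have "\<dots> = (\<Sum>i\<le>d. c i *\<^sub>R P i) *v v"
      by (simp add: vec_eq_iff matrix_vector_mult_def scaleR_sum_right sum_distrib_right sum.swap[of _ UNIV])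
    finally show ?thesis
      using c(2) by simp
  qed
  ultimately show ?thesis
    by (rule that)
qed

section \<open>Decay of implicit linear differential equations\<close>

text \<open>With \<open>\<phi> t = exp (- s t) g t\<close> the homogeneous part cancels and
  \<open>\<phi>' t = exp (- s t) h t\<close>, whose norm is at most \<open>H exp (b t)\<close> for \<open>b = - Re s - a > 0\<close>. The
  mean value inequality against the primitive \<open>(H / b) exp (b t)\<close> bounds \<open>\<phi>\<close>, hence \<open>g\<close>.\<close>
lemma forced_decay:
  fixes g h :: "real \<Rightarrow> complex"
  assumes "Re s < - a" and "0 \<le> H"
    and deriv: "\<And>t. 0 \<le> t \<Longrightarrow> (g has_vector_derivative s * g t + h t) (at t within {0..})"
    and h: "\<And>t. 0 \<le> t \<Longrightarrow> norm (h t) \<le> H * exp (- a * t)"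
    and "0 \<le> t"
  shows "norm (g t) \<le> (norm (g 0) + H / (- Re s - a)) * exp (- a * t)"
proof -
  define b where "b = - Re s - a"
  have b: "b > 0" using assms(1) by (simp add: b_def)
  define \<phi> where "\<phi> = (\<lambda>t. exp (- s * of_real t) * g t)"
  have \<phi>': "(\<phi> has_vector_derivative exp (- s * of_real t) * h t) (at t within {0..})" if "0 \<le> t" for t
    unfolding \<phi>_def
    by (rule derivative_eq_intros deriv that refl has_vector_derivative_real_field | simp add: algebra_simps)+
  have "norm (\<phi> t - \<phi> 0) \<le> H / b * exp (b * t) - H / b * exp (b * 0)"
  proof (cases "t = 0")
    case False
    with \<open>0 \<le> t\<close> have "0 < t" by simp
    then show ?thesis
    proof (rule differentiable_bound_general)
      show "continuous_on {0..t} \<phi>"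
        by (rule continuous_on_subset[of "{0..}"])
           (auto intro!: has_vector_derivative_continuous[OF \<phi>'] simp: continuous_on_eq_continuous_within)
      show "continuous_on {0..t} (\<lambda>t. H / b * exp (b * t))"
        by (intro continuous_intros)
    next
      fix x assume x: "0 < x" "x < t"
      show "(\<phi> has_vector_derivative exp (- s * of_real x) * h x) (at x)"
        using \<phi>'[of x] x at_within_open_subset[of x "{0<..}" "{0..}"] by (simp add: less_imp_le subset_eq)
      show "((\<lambda>t. H / b * exp (b * t)) has_vector_derivative H * exp (b * x)) (at x)"
        unfolding has_real_derivative_iff_has_vector_derivative[symmetric]
        using b by (auto intro!: derivative_eq_intros)
      have "norm (exp (- s * of_real x) * h x) \<le> exp (- Re s * x) * (H * exp (- a * x))"
        using h[of x] x by (simp add: norm_mult mult_left_mono)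
      also have "\<dots> = H * exp (b * x)"
        by (simp add: b_def algebra_simps flip: exp_add)
      finally show "norm (exp (- s * of_real x) * h x) \<le> H * exp (b * x)" .
    qed
  qed simp
  also have "\<dots> \<le> H / b * exp (b * t)"
    using b \<open>0 \<le> H\<close> by simp
  finally have "norm (\<phi> t) \<le> norm (g 0) + H / b * exp (b * t)"
    using norm_triangle_sub[of "\<phi> t" "\<phi> 0"] by (simp add: \<phi>_def)
  also have "\<dots> \<le> (norm (g 0) + H / b) * exp (b * t)"
    using b \<open>0 \<le> t\<close> by (simp add: distrib_right mult_left_mono[of 1 "exp (b * t)" "norm (g 0)", simplified])
  finally have "norm (\<phi> t) \<le> (norm (g 0) + H / b) * exp (b * t)" .
  moreover have "norm (g t) = exp (Re s * t) * norm (\<phi> t)"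
    by (simp add: \<phi>_def norm_mult flip: exp_add)
  ultimately have "norm (g t) \<le> exp (Re s * t) * ((norm (g 0) + H / b) * exp (b * t))"
    by simp
  also have "\<dots> = (norm (g 0) + H / b) * exp (- a * t)"
    by (simp add: b_def algebra_simps flip: exp_add)
  finally show ?thesis
    by (simp add: b_def)
qed



definition implicit_solutions :: "complex^'n^'n \<Rightarrow> (real \<Rightarrow> complex^'n) set" where
  "implicit_solutions N =
     {e. \<forall>t\<ge>0. \<exists>e'. (e has_vector_derivative e') (at t within {0..}) \<and> e t = N *v e'}"

lemma implicit_solutions_image:
  assumes "e \<in> implicit_solutions N" "bounded_linear f" "\<And>v. f (N *v v) = N *v f v"
  shows "(\<lambda>t. f (e t)) \<in> implicit_solutions N"
  unfolding implicit_solutions_def mem_Collect_eq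
proof (intro allI impI)
  fix t :: real assume "0 \<le> t"
  then obtain e' where "(e has_vector_derivative e') (at t within {0..})" "e t = N *v e'"
    using assms(1) by (auto simp: implicit_solutions_def)
  then show "\<exists>f'. ((\<lambda>t. f (e t)) has_vector_derivative f') (at t within {0..}) \<and> f (e t) = N *v f'"
    using bounded_linear.has_vector_derivative[OF assms(2)] assms(3) by metis
qed

text \<open>The identity \<open>L N e = 0\<close> can be differentiated: its derivative is \<open>L N e' = L e\<close>. So a
  factor \<open>N\<close> cancels in spite of \<open>N\<close> being possibly singular.\<close>
lemma implicit_solution_zero:
  assumes e: "e \<in> implicit_solutions N"
    and "bounded_linear L" and "\<And>v. L (N *v v) = N *v L v"
    and zero: "\<And>t. 0 \<le> t \<Longrightarrow> L (N *v e t) = 0" and "0 \<le> t"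
  shows "L (e t) = 0"
proof -
  obtain e' where e': "(e has_vector_derivative e') (at t within {0..})" "e t = N *v e'"
    using e \<open>0 \<le> t\<close> by (auto simp: implicit_solutions_def)
  have "((\<lambda>t. L (N *v e t)) has_vector_derivative L (N *v e')) (at t within {0..})"
    by (intro bounded_linear.has_vector_derivative[OF assms(2)]
        bounded_linear.has_vector_derivative[OF matrix_vector_mul_bounded_linear] e'(1))
  moreover have "((\<lambda>t. L (N *v e t)) has_vector_derivative 0) (at t within {0..})"
    by (rule has_vector_derivative_transform[of _ _ _ "\<lambda>_. 0"]) (use zero \<open>0 \<le> t\<close> in auto)
  moreover have "at t within {0..} \<noteq> bot"
  proof -
    have "at t within {t<..} \<noteq> bot" by simp
    moreover have "{t<..} \<subseteq> {0..}" using \<open>0 \<le> t\<close> by auto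
    ultimately show ?thesis
      using at_le[of "{t<..}" "{0..}" t] by (auto simp: bot.extremum_unique)
  qed
  ultimately show ?thesis
    using vector_derivative_unique_within e'(2) by metis
qed

lemma exponentially_stable_subset:
  "exponentially_stable T \<Longrightarrow> S \<subseteq> T \<Longrightarrow> exponentially_stable S"
  unfolding exponentially_stable_def by (meson subsetD)

lemma exponentially_stable_bounded_below:
  assumes "bounded_linear L" and B: "0 < B" "\<And>v. B * norm v \<le> norm (L v)"
    and T: "exponentially_stable T" and S: "\<And>e. e \<in> S \<Longrightarrow> (\<lambda>t. L (e t)) \<in> T"
  shows "exponentially_stable S"
proof -
  obtain l where l: "0 < l" "\<And>v. norm (L v) \<le> norm v * l"
    using bounded_linear.pos_bounded[OF assms(1)] by blast
  obtain c a where ca: "0 < c" "0 < a"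
    "\<And>e t. e \<in> T \<Longrightarrow> 0 \<le> t \<Longrightarrow> norm (e t) \<le> c * exp (- a * t) * norm (e 0)"
    using T unfolding exponentially_stable_def by blast
  have "norm (e t) \<le> (c * l / B) * exp (- a * t) * norm (e 0)" if "e \<in> S" "0 \<le> t" for e t
  proof -
    have "B * norm (e t) \<le> c * exp (- a * t) * norm (L (e 0))"
      using B(2)[of "e t"] ca(3)[OF S[OF that(1)] that(2)] by simp
    also have "\<dots> \<le> c * exp (- a * t) * (norm (e 0) * l)"
      using l ca(1) by (intro mult_left_mono) auto
    finally show ?thesis
      using B(1) by (simp add: field_simps)
  qed
  then show ?thesis
    unfolding exponentially_stable_def using ca l B(1)
    by (intro exI[of _ "c * l / B"] conjI exI[of _ a]) auto
qed

text \<open>Write \<open>f = z e - N e\<close> and \<open>s = 1/z\<close>. Differentiating \<open>f\<close> along \<open>e = N e'\<close> gives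
  \<open>f' = z e' - e\<close>, so \<open>g = e - s f\<close> satisfies \<open>g' = s e = s g + s\<^sup>2 f\<close>: an explicit equation with
  a stable coefficient and the decaying forcing term \<open>s\<^sup>2 f\<close>. Then \<open>e = g + s f\<close> decays as well.
  The argument runs in each coordinate, where the equation is scalar.\<close>
lemma exponentially_stable_eigenvalue:
  fixes N :: "complex^'n^'n"
  assumes z: "Re (inverse z) < 0" and T: "exponentially_stable T"
    and S: "S \<subseteq> implicit_solutions N" "\<And>e. e \<in> S \<Longrightarrow> (\<lambda>t. z *s e t - N *v e t) \<in> T"
  shows "exponentially_stable S"
proof -
  define s where "s = inverse z"
  have "z \<noteq> 0" using z by auto
  then have zs: "s * z = 1" by (simp add: s_def)
  have "bounded_linear (\<lambda>v :: complex^'n. z *s v - N *v v)"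
    by (rule bounded_linear_complex_linear[OF linear_scalar_minus_matrix])
  then obtain l where l: "0 < l" "\<And>v. norm (z *s v - N *v v) \<le> norm v * l"
    using bounded_linear.pos_bounded by blast
  obtain c b where cb: "0 < c" "0 < b"
    "\<And>f t. f \<in> T \<Longrightarrow> 0 \<le> t \<Longrightarrow> norm (f t) \<le> c * exp (- b * t) * norm (f 0)"
    using T unfolding exponentially_stable_def by blast
  \<comment> \<open>Half of \<open>- Re s\<close>, because at the rate \<open>- Re s\<close> itself the forced response could pick up a
    factor \<open>t\<close>.\<close>
  define a where "a = min b (- Re s / 2)"
  have a: "0 < a" "a \<le> b" "Re s < - a"
    using cb(2) z[folded s_def] by (auto simp: a_def)
  define H where "H = (norm s)\<^sup>2 * c * l"
  define k where "k = 1 + norm s * l + H / (- Re s - a) + norm s * (c * l)"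
  have pos: "0 \<le> H" "0 < k"
    using cb(1) l(1) a by (auto simp: H_def k_def intro!: add_pos_nonneg)
  have comp: "norm (e t $ j) \<le> k * exp (- a * t) * norm (e 0)" if e: "e \<in> S" and t: "0 \<le> t" for e t j
  proof -
    define f where "f = (\<lambda>t. z *s e t - N *v e t)"
    have f0: "norm (f 0) \<le> norm (e 0) * l"
      using l(2) by (simp add: f_def)
    have f: "norm (f t) \<le> c * l * norm (e 0) * exp (- a * t)" if "0 \<le> t" for t
    proof -
      have "norm (f t) \<le> c * exp (- b * t) * norm (f 0)"
        using cb(3)[OF S(2)[OF e] that] by (simp add: f_def)
      also have "\<dots> \<le> c * exp (- a * t) * (norm (e 0) * l)"
        using cb(1) a(2) f0 that by (intro mult_mono) (auto intro!: mult_right_mono)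
      finally show ?thesis by (simp add: mult_ac)
    qed
    define g where "g = (\<lambda>t. e t $ j - s * f t $ j)"
    have g': "(g has_vector_derivative s * g t + s\<^sup>2 * f t $ j) (at t within {0..})" if t0: "0 \<le> t" for t
    proof -
      obtain e' where e': "(e has_vector_derivative e') (at t within {0..})" "e t = N *v e'"
        using subsetD[OF S(1) e] t0 unfolding implicit_solutions_def by blast
      have comp': "((\<lambda>t. e t $ j) has_vector_derivative e' $ j) (at t within {0..})"
        by (rule bounded_linear.has_vector_derivative[OF bounded_linear_vec_nth e'(1)])
      have Ncomp': "((\<lambda>t. (N *v e t) $ j) has_vector_derivative e t $ j) (at t within {0..})"
        unfolding e'(2)
        by (intro bounded_linear.has_vector_derivative[OF bounded_linear_vec_nth]
             bounded_linear.has_vector_derivative[OF matrix_vector_mul_bounded_linear] e'(1))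
      have "(g has_vector_derivative e' $ j - s * (z * e' $ j - e t $ j)) (at t within {0..})"
        unfolding g_def f_def vector_minus_component vector_smult_component
        by (intro has_vector_derivative_diff has_vector_derivative_mult_right comp' Ncomp')
      moreover have "e' $ j - s * (z * e' $ j - e t $ j) = s * g t + s\<^sup>2 * f t $ j"
        using zs by (simp add: g_def power2_eq_square algebra_simps flip: mult.assoc)
      ultimately show ?thesis by simp
    qed
    have g0: "norm (g 0) \<le> norm (e 0) + norm s * (norm (e 0) * l)"
    proof -
      have "norm (g 0) \<le> norm (e 0 $ j) + norm s * norm (f 0 $ j)"
        unfolding g_def norm_mult[symmetric] by (rule norm_triangle_ineq4)
      also have "\<dots> \<le> norm (e 0) + norm s * (norm (e 0) * l)"
        using f0 Finite_Cartesian_Product.norm_nth_le[of "e 0" j]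
          Finite_Cartesian_Product.norm_nth_le[of "f 0" j]
        by (intro add_mono mult_left_mono) auto
      finally show ?thesis .
    qed
    have "norm (g t) \<le> (norm (g 0) + (H * norm (e 0)) / (- Re s - a)) * exp (- a * t)"
    proof (rule forced_decay[OF a(3) _ g' _ t])
      fix t :: real assume "0 \<le> t"
      have "norm (s\<^sup>2 * f t $ j) \<le> (norm s)\<^sup>2 * (c * l * norm (e 0) * exp (- a * t))"
        using f[OF \<open>0 \<le> t\<close>] Finite_Cartesian_Product.norm_nth_le[of "f t" j]
        unfolding norm_mult norm_power by (intro mult_left_mono) auto
      then show "norm (s\<^sup>2 * f t $ j) \<le> H * norm (e 0) * exp (- a * t)"
        by (simp add: H_def mult_ac)
    qed (use pos in auto)
    also have "\<dots> \<le> (1 + norm s * l + H / (- Re s - a)) * norm (e 0) * exp (- a * t)"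
      using g0 by (intro mult_right_mono) (auto simp: algebra_simps)
    finally have gt: "norm (g t) \<le> (1 + norm s * l + H / (- Re s - a)) * norm (e 0) * exp (- a * t)" .
    have "norm (e t $ j) \<le> norm (g t) + norm (s * f t $ j)"
      unfolding g_def by (metis add.commute norm_triangle_sub)
    also have "norm (s * f t $ j) \<le> norm s * (c * l * norm (e 0) * exp (- a * t))"
      using f[OF t] Finite_Cartesian_Product.norm_nth_le[of "f t" j]
      unfolding norm_mult by (intro mult_left_mono) auto
    finally show ?thesis
      using gt by (simp add: k_def algebra_simps)
  qed
  have "norm (e t) \<le> real CARD('n) * k * exp (- a * t) * norm (e 0)" if "e \<in> S" "0 \<le> t" for e t
  proof -
    have "norm (e t) \<le> (\<Sum>j\<in>UNIV. norm (e t $ j))"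
      unfolding norm_vec_def by (rule L2_set_le_sum) auto
    also have "\<dots> \<le> (\<Sum>j\<in>(UNIV :: 'n set). k * exp (- a * t) * norm (e 0))"
      by (intro sum_mono comp that)
    finally show ?thesis by (simp add: mult_ac)
  qed
  then show ?thesis
    unfolding exponentially_stable_def using pos a
    by (intro exI[of _ "real CARD('n) * k"] conjI exI[of _ a]) auto
qed

text \<open>The decay rate and the constant worsen with each factor that is split off; the bound
  stays uniform over the solutions, because the factors are those of the fixed polynomial \<open>p\<close>.\<close>
lemma annihilated_implicit_solutions_stable:
  fixes N :: "complex^'n^'n"
  assumes spec: "\<And>z v. v \<noteq> 0 \<Longrightarrow> N *v v = z *s v \<Longrightarrow> z \<noteq> 0 \<Longrightarrow> Re (inverse z) < 0"
    and "p \<noteq> 0"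
  shows "exponentially_stable {e \<in> implicit_solutions N. \<forall>t\<ge>0. mat_poly N p (e t) = 0}"
  using \<open>p \<noteq> 0\<close>
proof (induction p rule: poly_root_induct[where P = "\<lambda>_. True"])
  case 0
  then show ?case by simp
next
  case (no_roots p)
  then have "constant (poly p)"
    using fundamental_theorem_of_algebra by blast
  then obtain a where "p = [:a:]"
    by (metis constant_degree degree_eq_zeroE)
  \<comment> \<open>A nonzero constant annihilates only the zero solution.\<close>
  then have p: "p = [:a:]" "a \<noteq> 0"
    using no_roots by auto
  show ?case
    unfolding exponentially_stable_def
    by (intro exI[of _ 1] conjI ballI allI impI) (use p in auto)
next
  case (root z p)
  then have "p \<noteq> 0" by auto
  let ?L = "\<lambda>v. z *s v - N *v v"
  note lin = linear_scalar_minus_matrix[of z N]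
  note bl = bounded_linear_complex_linear[OF lin]
  let ?S = "{e \<in> implicit_solutions N. \<forall>t\<ge>0. mat_poly N ([:z, -1:] * p) (e t) = 0}"
  let ?T = "{e \<in> implicit_solutions N. \<forall>t\<ge>0. mat_poly N p (e t) = 0}"
  have ST: "(\<lambda>t. ?L (e t)) \<in> ?T" if "e \<in> ?S" for e
  proof -
    have "?L (N *v v) = N *v ?L v" for v
      by (simp add: vec.diff vec.scale)
    then have "(\<lambda>t. ?L (e t)) \<in> implicit_solutions N"
      using that implicit_solutions_image[OF _ bl] by blast
    then show ?thesis
      using that by (simp only: mat_poly_linear_factor) simp
  qed
  have IH: "exponentially_stable ?T"
    by (rule root.IH[OF \<open>p \<noteq> 0\<close>])
  consider "z = 0" | "z \<noteq> 0" "\<exists>v. v \<noteq> 0 \<and> N *v v = z *s v" | "\<forall>v. N *v v = z *s v \<longrightarrow> v = 0"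
    by blast
  then show ?case
  proof cases
    case 1
    have "?S \<subseteq> ?T"
    proof safe
      fix e :: "real \<Rightarrow> complex^'n" and t :: real
      assume e: "e \<in> implicit_solutions N" "\<forall>t\<ge>0. mat_poly N ([:z, -1:] * p) (e t) = 0" and "0 \<le> t"
      show "mat_poly N p (e t) = 0"
      proof (rule implicit_solution_zero[OF e(1) bounded_linear_complex_linear[OF linear_mat_poly]
            mat_poly_commute _ \<open>0 \<le> t\<close>])
        fix t :: real assume "0 \<le> t"
        then have "mat_poly N p (- (N *v e t)) = 0"
          using e(2) 1 by (simp only: mat_poly_linear_factor) simp
        then show "mat_poly N p (N *v e t) = 0"
          by (simp add: vec.linear_neg[OF linear_mat_poly])
      qed
    qed
    with IH show ?thesis
      by (rule exponentially_stable_subset)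
  next
    case 2
    then have "Re (inverse z) < 0" using spec by blast
    then show ?thesis
      by (rule exponentially_stable_eigenvalue[OF _ IH _ ST]) auto
  next
    case 3
    then have "inj ?L"
      using vec.linear_inj_iff_eq_0[OF lin] by auto
    then obtain B where "B > 0" "\<And>v. B * norm v \<le> norm (?L v)"
      using linear_inj_bounded_below_pos[OF bounded_linear.linear[OF bl]] by blast
    then show ?thesis
      by (rule exponentially_stable_bounded_below[OF bl _ _ IH ST])
  qed
qed

lemma implicit_solutions_stable:
  fixes N :: "complex^'n^'n"
  assumes "\<And>z v. v \<noteq> 0 \<Longrightarrow> N *v v = z *s v \<Longrightarrow> z \<noteq> 0 \<Longrightarrow> Re (inverse z) < 0"
  shows "exponentially_stable (implicit_solutions N)"
proof -
  obtain p where "p \<noteq> 0" "\<And>v. mat_poly N p v = 0"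
    using annihilating_polynomial[of N] by metis
  moreover have "exponentially_stable {e \<in> implicit_solutions N. \<forall>t\<ge>0. mat_poly N p (e t) = 0}"
    by (rule annihilated_implicit_solutions_stable) (fact assms, fact)
  ultimately show ?thesis by simp
qed

section \<open>Hurwitz pairs\<close>

definition cvec :: "real^'n \<Rightarrow> complex^'n" where
  "cvec v = (\<chi> i. complex_of_real (v $ i))"

definition cmat :: "real^'n^'m \<Rightarrow> complex^'n^'m" where
  "cmat A = (\<chi> i j. complex_of_real (A $ i $ j))"

lemma cvec_nth [simp]: "cvec v $ i = complex_of_real (v $ i)"
  by (simp add: cvec_def)

lemma norm_cvec [simp]: "norm (cvec v) = norm v"
  by (simp add: norm_vec_def)

lemma bounded_linear_cvec: "bounded_linear cvec"
  by (rule bounded_linear_intro[where K = 1]) (simp_all add: vec_eq_iff scaleR_conv_of_real[where 'a = complex])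

lemma cmat_mult_cvec: "cmat A *v cvec v = cvec (A *v v)"
  by (simp add: cmat_def cvec_def matrix_vector_mult_def vec_eq_iff)

lemma pencil_mult: "pencil E M s *v v = s *s (cmat E *v v) - cmat M *v v"
  by (simp add: pencil_def cmat_def matrix_vector_mult_def vec_eq_iff left_diff_distrib
      sum_subtractf sum_distrib_left mult.assoc)

text \<open>A Hurwitz pair has an invertible \<open>M\<close>, so \<open>E e' = M e\<close> is the implicit equation
  \<open>e = N e'\<close> for \<open>N = M\<^sup>-\<^sup>1 E\<close>. An eigenvalue \<open>z \<noteq> 0\<close> of \<open>N\<close> makes \<open>1/z\<close> a generalized eigenvalue
  of the pair. Complexification preserves norms, so the constants carry over to the real
  solutions.\<close>
lemma hurwitz_pair_stable:
  fixes E M :: "real^'n^'n"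
  assumes "hurwitz_pair E M"
  shows "exponentially_stable {e. descriptor_solution E M (\<lambda>_. 0) e}"
proof -
  have kernel: "Re s < 0" if "v \<noteq> 0" "s *s (cmat E *v v) = cmat M *v v" for s v
  proof -
    have "pencil E M s *v v = 0"
      using that(2) by (simp add: pencil_mult)
    with that(1) have "\<not> inj ((*v) (pencil E M s))"
      by (auto simp: vec.inj_iff_eq_0)
    then have "det (pencil E M s) = 0"
      using inj_matrix_vector_mult invertible_det_nz by blast
    then show ?thesis
      using assms by (simp add: hurwitz_pair_def)
  qed
  have "inj ((*v) (cmat M))"
    using kernel[of _ 0] by (auto simp: vec.inj_iff_eq_0)
  then obtain W where W: "W ** cmat M = mat 1"
    by (auto simp flip: matrix_left_invertible_injective)
  then have W': "cmat M ** W = mat 1"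
    by (simp add: matrix_left_right_inverse)
  define N where "N = W ** cmat E"
  have "exponentially_stable (implicit_solutions N)"
  proof (rule implicit_solutions_stable)
    fix z v assume v: "v \<noteq> 0" "N *v v = z *s v" "z \<noteq> 0"
    have "cmat M *v (N *v v) = cmat E *v v"
      using W' by (simp add: N_def matrix_vector_mul_assoc matrix_mul_assoc)
    then have "inverse z *s (cmat E *v v) = cmat M *v v"
      using v by (simp add: vec.scale vector_smult_assoc flip: \<open>cmat M *v (N *v v) = cmat E *v v\<close>)
    with v(1) show "Re (inverse z) < 0"
      by (rule kernel)
  qed
  then obtain c a where ca: "0 < c" "0 < a"
    "\<And>e t. e \<in> implicit_solutions N \<Longrightarrow> 0 \<le> t \<Longrightarrow> norm (e t) \<le> c * exp (- a * t) * norm (e 0)"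
    unfolding exponentially_stable_def by blast
  have mem: "(\<lambda>t. cvec (e t)) \<in> implicit_solutions N" if e: "descriptor_solution E M (\<lambda>_. 0) e" for e
    unfolding implicit_solutions_def mem_Collect_eq
  proof (intro allI impI)
    fix t :: real assume "0 \<le> t"
    then obtain e' where e': "(e has_vector_derivative e') (at t within {0..})" "E *v e' = M *v e t"
      using e by (auto simp: descriptor_solution_def)
    have "N *v cvec e' = W *v (cmat M *v cvec (e t))"
      by (simp add: N_def cmat_mult_cvec e'(2) flip: matrix_vector_mul_assoc)
    also have "\<dots> = cvec (e t)"
      by (simp add: matrix_vector_mul_assoc W)
    finally show "\<exists>f'. ((\<lambda>t. cvec (e t)) has_vector_derivative f') (at t within {0..}) \<and> cvec (e t) = N *v f'"
      using bounded_linear.has_vector_derivative[OF bounded_linear_cvec e'(1)] by metis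
  qed
  show ?thesis
    unfolding exponentially_stable_def using ca mem norm_cvec
    by (metis (no_types, lifting) mem_Collect_eq)
qed

section \<open>The detection filter\<close>

lemma cols_mult_eq_0: "(\<And>k. k \<in> K \<Longrightarrow> v $ k = 0) \<Longrightarrow> cols_mult M K v = 0"
  by (simp add: cols_mult_def)

lemma attack_free_error_solution:
  assumes u: "\<forall>t\<ge>0. \<forall>k\<in>K. u t $ k = 0"
    and "plant E A C K u x y" "detection_filter E A C G y w r"
  shows "descriptor_solution E (A + G ** C) (\<lambda>_. 0) (\<lambda>t. w t - x t)"
    and "\<forall>t\<ge>0. r t = C *v (w t - x t)"
proof -
  have y: "y t = C *v x t" if "0 \<le> t" for t
    using assms that by (simp add: plant_def cols_mult_eq_0)
  then show "\<forall>t\<ge>0. r t = C *v (w t - x t)"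
    using assms(3) by (simp add: detection_filter_def vec.diff)
  show "descriptor_solution E (A + G ** C) (\<lambda>_. 0) (\<lambda>t. w t - x t)"
    unfolding descriptor_solution_def
  proof (intro allI impI)
    fix t :: real assume t: "0 \<le> t"
    obtain x' where x': "(x has_vector_derivative x') (at t within {0..})" "E *v x' = A *v x t"
      using assms(2) u t unfolding plant_def descriptor_solution_def 
      by (force simp: cols_mult_eq_0)
    obtain w' where w': "(w has_vector_derivative w') (at t within {0..})"
        "E *v w' = (A + G ** C) *v w t - G *v y t"
      using assms(3) t unfolding detection_filter_def descriptor_solution_def by force
    have "E *v (w' - x') = (A + G ** C) *v (w t - x t) + 0"
      using x'(2) w'(2) y[OF t]
      by (simp add: vec.diff matrix_vector_mult_add_rdistrib matrix_vector_mul_assoc)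
    then show "\<exists>e'. ((\<lambda>t. w t - x t) has_vector_derivative e') (at t within {0..}) \<and>
        E *v e' = (A + G ** C) *v (w t - x t) + 0"
      using has_vector_derivative_diff[OF w'(1) x'(1)] by blast
  qed
qed

text \<open>At time \<open>0\<close> the right-hand side equals \<open>E x'(0)\<close>, and the range of \<open>E\<close> is orthogonal to
  the kernel of \<open>E\<^sup>T\<close>.\<close>
lemma descriptor_solution_consistent:
  assumes "descriptor_solution E A f x"
  shows "consistent E A (x 0) (f 0)"
  unfolding consistent_def
proof (intro allI impI)
  fix v assume v: "transpose E *v v = 0"
  obtain x' where "E *v x' = A *v x 0 + f 0"
    using assms by (auto simp: descriptor_solution_def)
  moreover have "(E *v x') \<bullet> v = x' \<bullet> (transpose E *v v)"
    by (metis dot_lmul_matrix inner_commute transpose_matrix_vector)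
  ultimately show "orthogonal (A *v x 0 + f 0) v"
    using v by (simp add: orthogonal_def)
qed

text \<open>With a vanishing residual \<open>G C w - G y = 0\<close>, so the filter is a copy of the unattacked
  system.\<close>
lemma undetected_filter_generates_output:
  assumes "detection_filter E A C G y w r" and r: "\<forall>t\<ge>0. r t = 0"
  shows "generates_output E A C K (w 0) (\<lambda>_. 0) (\<lambda>t. C *v w t)" "\<forall>t\<ge>0. y t = C *v w t"
proof -
  show y: "\<forall>t\<ge>0. y t = C *v w t"
    using assms by (simp add: detection_filter_def)
  have "descriptor_solution E A (\<lambda>_. 0) w"
    using assms(1) y unfolding detection_filter_def descriptor_solution_def
    by (simp add: matrix_vector_mult_add_rdistrib matrix_vector_mul_assoc)
  then show "generates_output E A C K (w 0) (\<lambda>_. 0) (\<lambda>t. C *v w t)"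
    using descriptor_solution_consistent[of E A "\<lambda>_. 0" w]
    by (auto simp: generates_output_def plant_def cols_mult_eq_0)
qed

theorem theorem3p1:
  fixes E A :: "real^'n::finite^'n::finite" and C :: "real^'n^'p::finite" and G :: "real^'p^'n"
    and K :: "('n + 'p) set"
  assumes "regular_pair E A"
    and "detectable E A C K"
    and "regular_pair E (A + G ** C)"
    and "hurwitz_pair E (A + G ** C)"
  shows "(\<forall>u x y w r.
            attack_mode K u \<or> no_attack u \<longrightarrow>
            plant E A C K u x y \<longrightarrow>
            detection_filter E A C G y w r \<longrightarrow>
            w 0 = x 0 \<longrightarrow>
            ((\<forall>t\<ge>0. r t = 0) \<longleftrightarrow> (\<forall>t\<ge>0. \<forall>k\<in>K. u t $ k = 0)))
         \<and> exponentially_stable (attack_free_errors E A C G K)"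
proof (intro conjI allI impI iffI)
  note stable = hurwitz_pair_stable[OF assms(4)]
  {
    fix u x y w r and t :: real
    assume plant: "plant E A C K u x y" and filter: "detection_filter E A C G y w r"
      and init: "w 0 = x 0" and u: "\<forall>t\<ge>0. \<forall>k\<in>K. u t $ k = 0" and "0 \<le> t"
    note sol = attack_free_error_solution[OF u plant filter]
    have "norm (w t - x t) \<le> 0"
      using stable sol(1) init \<open>0 \<le> t\<close> unfolding exponentially_stable_def by fastforce
    then show "r t = 0"
      using sol(2) \<open>0 \<le> t\<close> by simp
  next
    fix u x y w r
    assume mode: "attack_mode K u \<or> no_attack u" and plant: "plant E A C K u x y"
      and filter: "detection_filter E A C G y w r" and r: "\<forall>t\<ge>0. r t = 0"
    have "\<not> attack_mode K u"
    proof
      assume "attack_mode K u"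
      moreover have "generates_output E A C K (x 0) u y"
        using plant by (auto simp: generates_output_def)
      ultimately have "undetectable E A C K"
        unfolding undetectable_def using undetected_filter_generates_output[OF filter r] by blast
      then show False
        using assms(2) by (simp add: detectable_def)
    qed
    then show "\<forall>k\<in>K. u t $ k = 0" if "0 \<le> t" for t
      using mode that by (simp add: no_attack_def)
  }
  have "attack_free_errors E A C G K \<subseteq> {e. descriptor_solution E (A + G ** C) (\<lambda>_. 0) e}"
  proof
    fix e assume "e \<in> attack_free_errors E A C G K"
    then obtain u x y w r where *: "no_attack u" "plant E A C K u x y" "detection_filter E A C G y w r"
      and e: "e = (\<lambda>t. w t - x t)"
      by (auto simp: attack_free_errors_def)
    have "\<forall>t\<ge>0. \<forall>k\<in>K. u t $ k = 0"
      using *(1) by (simp add: no_attack_def)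
    with * e show "e \<in> {e. descriptor_solution E (A + G ** C) (\<lambda>_. 0) e}"
      using attack_free_error_solution(1) by blast
  qed
  with stable show "exponentially_stable (attack_free_errors E A C G K)"
    by (rule exponentially_stable_subset)
qed

end
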